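(* Let $d\ge 2$ be an integer. Identify the points of ${\rm PG}(2d-1,3)$ with the nonzero elements of ${\mathbb F}_{3^{2d}}$ modulo ${\mathbb F}_3^*$ (so that $\langle x\rangle=\langle y\rangle$ iff $x/y\in{\mathbb F}_3$). Then the set $$\theta_0=\{\langle x\rangle \mid x\in{\mathbb F}_{3^{2d}},\ x^{3^d+1}=1\}$$ is a complete $4$-general set of ${\rm PG}(2d-1,3)$ of size $\frac{3^d+1}{2}$.
   Context: ${\mathbb F}_{3^{2d}}$ is viewed as a $2d$-dimensional ${\mathbb F}_3$-vector space, so its nonzero elements up to ${\mathbb F}_3^*$-multiples are the points of ${\rm PG}(2d-1,3)$; points $\langle x\rangle,\langle y\rangle,\langle z\rangle,\langle t\rangle$ are coplanar iff $t=ax+by+cz$ for some $a,b,c\in{\mathbb F}_3$ (or the points are otherwise linearly dependent). A $4$-general set of ${\rm PG}(n,q)$ is a set of points spanning ${\rm PG}(n,q)$ such that no four of its points lie on a plane; it is complete if it is not contained in a strictly larger $4$-general set. *)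

theory Defs
  imports Complex_Main "HOL-Library.Cardinality"
begin

text \<open>The projective space of a vector space: the points and planes are the linear subspaces
  of vector space dimension 1 and 3.\<close>

locale projective_space = vector_space
begin

definition proj_points :: "'b set set" where
  "proj_points = {P. subspace P \<and> dim P = 1}"

definition planes :: "'b set set" where
  "planes = {E. subspace E \<and> dim E = 3}"

definition four_general :: "'b set set \<Rightarrow> bool" where
  "four_general X \<longleftrightarrow>
     X \<subseteq> proj_points \<and> span (\<Union>X) = UNIV \<and>
     \<not> (\<exists>Y\<subseteq>X. card Y = 4 \<and> (\<exists>E\<in>planes. \<forall>P\<in>Y. P \<subseteq> E))"

definition complete_four_general :: "'b set set \<Rightarrow> bool" where
  "complete_four_general X \<longleftrightarrow>
     four_general X \<and> \<not> (\<exists>Y. four_general Y \<and> X \<subset> Y)"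

end

text \<open>A field extension given by an embedding of the small field; the large field is viewed as a
  vector space over the small one.\<close>

locale field_extension =
  fixes emb :: "'k::field \<Rightarrow> 'a::field"
  assumes emb_one: "emb 1 = 1"
    and emb_add: "emb (a + b) = emb a + emb b"
    and emb_mult: "emb (a * b) = emb a * emb b"
begin

sublocale projective_space "\<lambda>c x. emb c * x"
  by unfold_locales (simp_all add: emb_one emb_add emb_mult algebra_simps)

definition theta0 :: "nat \<Rightarrow> 'a set set" where
  "theta0 d = {span {x} | x. x ^ (3 ^ d + 1) = 1}"

end

end

theory Submission
  imports Defs "HOL-Computational_Algebra.Polynomial"
begin

text \<open>Let \<open>q = 3\<^sup>d\<close> and let \<open>U\<close> be the group of all \<open>x\<close> with \<open>x\<^sup>q\<^sup>+\<^sup>1 = 1\<close>, so that \<open>x\<^sup>q = 1/x\<close> on \<open>U\<close>.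
  Applying the additive map \<open>x \<mapsto> x\<^sup>q\<close> to a vanishing sum of at most four elements of \<open>U\<close> shows
  that the sum of the inverses vanishes as well; the two relations force two of the elements to be
  equal or opposite. Since the nonzero scalars are \<open>\<plusminus>1\<close>, any four points of \<open>\<theta>\<^sub>0\<close> are independent.

  For completeness, every \<open>t\<close> other than \<open>0\<close> and the elements of \<open>U\<close> is a sum of three elements
  of \<open>U\<close>, hence coplanar with three points of \<open>\<theta>\<^sub>0\<close>: as \<open>x\<close> and \<open>y\<close> range over \<open>U\<close>, the norms
  of \<open>t - x\<close> and of \<open>-1 - y\<close> each take at least \<open>(q + 1)/2\<close> of the \<open>q\<close> possible values, so they
  agree for some \<open>x\<close> and \<open>y\<close>, and then \<open>t - x = v (-1 - y)\<close> with \<open>v\<close> in \<open>U\<close>.\<close>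

section \<open>Fibre counting and elementary facts on finite fields\<close>

lemma card_le_mult_card_image:
  assumes "finite A" and "\<And>y. y \<in> f ` A \<Longrightarrow> card {x \<in> A. f x = y} \<le> k"
  shows "card A \<le> k * card (f ` A)"
proof -
  have "card A = (\<Sum>y\<in>f ` A. card {x \<in> A. f x = y})"
    using sum.image_gen[OF assms(1), of "\<lambda>_. 1::nat" f] by simp
  also have "\<dots> \<le> (\<Sum>y\<in>f ` A. k)"
    by (intro sum_mono assms(2))
  finally show ?thesis by (simp add: mult.commute)
qed

lemma card_eq_mult_card_image:
  assumes "finite A" and "\<And>y. y \<in> f ` A \<Longrightarrow> card {x \<in> A. f x = y} = k"
  shows "card A = k * card (f ` A)"
  using sum.image_gen[OF assms(1), of "\<lambda>_. 1::nat" f] assms(2) by (simp add: mult.commute)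

lemma card_nth_roots_le:
  fixes a :: "'a::idom"
  assumes "n > 0"
  shows "card {x. x ^ n = a} \<le> n"
proof -
  let ?p = "monom 1 n - [:a:]"
  have "coeff ?p n = 1"
    using assms by (simp add: coeff_pCons split: nat.split)
  then have "?p \<noteq> 0" by force
  then have "card {x. poly ?p x = 0} \<le> degree ?p"
    by (rule card_poly_roots_bound)
  also have "\<dots> \<le> n"
    by (intro degree_diff_le degree_monom_le) simp
  finally show ?thesis by (simp add: poly_monom)
qed

text \<open>Multiplication by \<open>a\<close> permutes the nonzero elements, so their product is
  unchanged when every factor is multiplied by \<open>a\<close>; cancelling this product leaves the
  power of \<open>a\<close>.\<close>

lemma finite_field_power_card_minus_one:
  fixes a :: "'a::field"
  assumes fin: "finite (UNIV :: 'a set)" and "a \<noteq> 0"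
  shows "a ^ (CARD('a) - 1) = 1"
proof -
  let ?S = "UNIV - {0 :: 'a}"
  have "bij_betw ((*) a) ?S ?S"
    by (rule bij_betw_byWitness[where f' = "\<lambda>x. x / a"]) (use assms in auto)
  then have "(\<Prod>x\<in>?S. x) = (\<Prod>x\<in>?S. a * x)"
    using prod.reindex_bij_betw[of "(*) a" ?S ?S "\<lambda>x. x"] by simp
  also have "\<dots> = a ^ card ?S * (\<Prod>x\<in>?S. x)"
    by (simp add: prod.distrib)
  finally show ?thesis
    using fin by (simp add: card_Diff_singleton)
qed

lemma field_card_3:
  assumes "CARD('k::field) = 3"
  shows "(UNIV :: 'k set) = {0, 1, -1}" "(1 + 1 + 1 :: 'k) = 0"
proof -
  have fin: "finite (UNIV :: 'k set)"
    using assms by (intro card_ge_0_finite) simp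
  have ne: "(1 :: 'k) \<noteq> - 1"
  proof
    assume "(1 :: 'k) = - 1"
    then have "(1 :: 'k) + 1 = 0" by (simp only: eq_neg_iff_add_eq_0)
    then have "z * (1 + 1) = 0" for z :: 'k by (simp only: mult_zero_right)
    then have two: "z + z = 0" for z :: 'k by (simp only: distrib_left mult.right_neutral)
    \<comment> \<open>In characteristic 2 a third element \<open>z\<close> brings
      \<open>z + 1\<close> as a fourth, which is too many for a field of three elements.\<close>
    have "(UNIV :: 'k set) \<noteq> {0, 1}"
      using assms by (metis card_2_iff numeral_eq_iff semiring_norm(89) zero_neq_one)
    then obtain z :: 'k where z: "z \<noteq> 0" "z \<noteq> 1" by blast
    moreover have "z + 1 \<noteq> 0"
    proof
      assume "z + 1 = 0"
      then have "z + 1 = 1 + 1" using two[of 1] by simp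
      then show False using z by (simp only: add_right_cancel)
    qed
    ultimately have "card {0, 1, z, z + 1} = 4"
      by simp
    then show False
      using card_mono[OF fin, of "{0, 1, z, z + 1}"] assms by simp
  qed
  then have "card {0, 1, - 1 :: 'k} = 3" by simp
  then show UNIV: "(UNIV :: 'k set) = {0, 1, -1}"
    using card_subset_eq[OF fin subset_UNIV, of "{0, 1, - 1}"] assms by simp
  have "(1 + 1 :: 'k) \<in> {0, 1, -1}"
    unfolding UNIV[symmetric] by (rule UNIV_I)
  then consider "(1 + 1 :: 'k) = 0" | "(1 + 1 :: 'k) = 1" | "(1 + 1 :: 'k) = - 1" by blast
  then show "(1 + 1 + 1 :: 'k) = 0"
  proof cases
    case 1
    then have "(1 :: 'k) = - 1" by (simp only: eq_neg_iff_add_eq_0)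
    then show ?thesis using ne by contradiction
  next
    case 2
    then have "(1 :: 'k) + 1 = 1 + 0" by (simp only: add_0_right)
    then have "(1 :: 'k) = 0" by (simp only: add_left_cancel)
    then show ?thesis by simp
  next
    case 3
    then show ?thesis by (simp only: add.left_inverse)
  qed
qed

section \<open>The ambient field over the field of three elements: scalars and Frobenius\<close>

locale ternary_extension = field_extension emb for emb :: "'k::field \<Rightarrow> 'a::field" +
  fixes d :: nat
  assumes d_ge_2: "d \<ge> 2"
    and card_base: "CARD('k) = 3"
    and card_ext: "CARD('a) = 3 ^ (2 * d)"
begin

abbreviation q :: nat where "q \<equiv> 3 ^ d"

text \<open>The kernel of the norm \<open>x ^ (q + 1)\<close> from the field of \<open>q^2\<close>
  elements to its subfield of \<open>q\<close> elements.\<close>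

definition norm_one :: "'a set" where
  "norm_one = {x. x ^ (q + 1) = 1}"

lemma one_less_q: "1 < q"
  using d_ge_2 by (intro one_less_power) auto

lemma card_ext_minus_one: "CARD('a) - 1 = (q - 1) * (q + 1)"
  unfolding card_ext mult_2 power_add by (simp add: diff_mult_distrib)

lemma finite_UNIV_ext: "finite (UNIV :: 'a set)"
  using card_ext by (intro card_ge_0_finite) simp

lemma finite_ext [simp, intro]: "finite (A :: 'a set)"
  by (rule finite_subset[OF subset_UNIV finite_UNIV_ext])

lemma emb_simps [simp]: "emb 0 = 0" "emb (- 1) = - 1"
proof -
  have "emb 0 + emb 0 = emb 0 + 0"
    by (simp only: emb_add[symmetric] add_0_right)
  then show zero: "emb 0 = 0"
    by (simp only: add_left_cancel)
  have "emb (- 1) + emb 1 = 0"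
    unfolding emb_add[symmetric] add.left_inverse by (rule zero)
  then show "emb (- 1) = - 1"
    by (simp only: emb_one eq_neg_iff_add_eq_0)
qed

text \<open>The first alternative also records \<open>c = 0\<close>, so that a nonzero coefficient
  acts as a sign without appeal to injectivity of \<open>emb\<close>.\<close>

lemma emb_cases: "emb c = 0 \<and> c = 0 \<or> emb c = 1 \<or> emb c = - 1"
  using UNIV_I[of c, unfolded field_card_3(1)[OF card_base]] by (auto simp: emb_one)

lemma char_3: "x + x + x = (0 :: 'a)"
proof -
  have "emb (1 + 1 + 1) = 0"
    using field_card_3(2)[OF card_base] by simp
  then have "1 + 1 + 1 = (0 :: 'a)"
    by (simp only: emb_add emb_one)
  then have "x * (1 + 1 + 1) = 0" by simp
  then show ?thesis by (simp add: algebra_simps)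
qed

lemma neg_eq_iff: "- x = x \<longleftrightarrow> x = (0 :: 'a)"
  using char_3[of x] by (metis add.right_inverse add_0 neg_0_equal_iff_equal)

lemma span_single: "span {x} = {0, x, - x}"
proof -
  have "range emb = emb ` {0, 1, - 1}"
    by (rule arg_cong[OF field_card_3(1)[OF card_base]])
  then have "range emb = {0, 1, - 1}" by (simp add: emb_one)
  then have "(\<lambda>c. c * x) ` range emb = {0, x, - x}" by simp
  then show ?thesis
    unfolding span_singleton by (simp add: image_image)
qed

lemma span_single_eq_iff: "span {x} = span {y} \<longleftrightarrow> x = y \<or> x = - y"
proof
  assume "span {x} = span {y}"
  then have eq: "{0, x, - x} = {0, y, - y}" by (simp add: span_single)
  then have "x \<in> {0, y, - y}" by blast
  moreover have "y = 0" if "x = 0" using eq that by auto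
  ultimately show "x = y \<or> x = - y" by auto
qed (auto simp: span_single)

lemma cube_add: "(x + y) ^ 3 = x ^ 3 + (y :: 'a) ^ 3"
proof -
  have "(x + y) ^ 3 = x ^ 3 + y ^ 3 + (x * y * (x + y) + x * y * (x + y) + x * y * (x + y))"
    by (simp add: power3_eq_cube algebra_simps)
  then show ?thesis by (simp only: char_3) simp
qed

text \<open>The map \<open>x ^ q\<close> is the \<open>d\<close>-th iterate of cubing, which is
  additive in characteristic 3. It is the conjugation over the subfield of \<open>q\<close>
  elements.\<close>

lemma conj_add: "(x + y) ^ q = x ^ q + (y :: 'a) ^ q"
proof -
  have "(x + y) ^ (3 ^ n) = x ^ (3 ^ n) + y ^ (3 ^ n)" for n
  proof (induction n)
    case (Suc n)
    have "z ^ (3 ^ Suc n) = (z ^ (3 ^ n)) ^ 3" for z :: 'a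
      by (simp only: power_Suc2 power_mult)
    then show ?case
      by (simp only: Suc.IH cube_add)
  qed simp
  then show ?thesis .
qed

lemma conj_minus: "(- x) ^ q = - ((x :: 'a) ^ q)"
  by (simp add: power_minus_odd)

lemma conj_diff: "(x - y) ^ q = x ^ q - (y :: 'a) ^ q"
  using conj_add[of x "- y"] by (simp add: conj_minus)

section \<open>The norm-one group and the points it represents\<close>

lemma norm_oneD:
  assumes "x \<in> norm_one"
  shows "x \<noteq> 0" "x ^ q = inverse x" "- x \<in> norm_one" "x \<noteq> - x"
proof -
  have x: "x * x ^ q = 1" using assms by (simp add: norm_one_def)
  then show "x \<noteq> 0" by auto
  then show "x \<noteq> - x" by (metis neg_eq_iff)
  show "x ^ q = inverse x" using x by (metis inverse_unique)
  show "- x \<in> norm_one" using x by (simp add: norm_one_def conj_minus)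
qed

lemma norm_one_mult: "x \<in> norm_one \<Longrightarrow> y \<in> norm_one \<Longrightarrow> x * y \<in> norm_one"
  unfolding norm_one_def by (simp only: mem_Collect_eq power_mult_distrib) simp

lemma norm_one_divide:
  "x ^ (q + 1) = y ^ (q + 1) \<Longrightarrow> y \<noteq> 0 \<Longrightarrow> x / y \<in> norm_one"
  unfolding norm_one_def by (simp only: mem_Collect_eq power_divide) simp

lemma power_card_minus_one:
  assumes "x \<noteq> (0 :: 'a)"
  shows "x ^ ((q - 1) * (q + 1)) = 1"
  using finite_field_power_card_minus_one[OF finite_UNIV_ext assms] card_ext_minus_one by simp

text \<open>The upper bound counts roots. For the lower bound, the map \<open>x ^ (q - 1)\<close>
  sends the \<open>(q - 1) * (q + 1)\<close> nonzero elements into \<open>norm_one\<close>, with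
  fibres of size at most \<open>q - 1\<close>.\<close>

lemma card_norm_one: "card norm_one = q + 1"
proof (rule antisym)
  show "card norm_one \<le> q + 1"
    unfolding norm_one_def by (rule card_nth_roots_le) simp
  let ?S = "UNIV - {0 :: 'a}"
  note q = one_less_q
  have "card ?S \<le> (q - 1) * card ((\<lambda>x. x ^ (q - 1)) ` ?S)"
  proof (rule card_le_mult_card_image)
    fix y :: 'a
    have "card {x \<in> ?S. x ^ (q - 1) = y} \<le> card {x. x ^ (q - 1) = y}"
      by (intro card_mono) auto
    also have "\<dots> \<le> q - 1"
      using q by (intro card_nth_roots_le) simp
    finally show "card {x \<in> ?S. x ^ (q - 1) = y} \<le> q - 1" .
  qed simp
  also have "\<dots> \<le> (q - 1) * card norm_one"
  proof (intro mult_left_mono card_mono)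
    show "(\<lambda>x. x ^ (q - 1)) ` ?S \<subseteq> norm_one"
      using power_card_minus_one by (auto simp: norm_one_def power_mult[symmetric] simp del: power_Suc)
  qed auto
  finally have "card ?S \<le> (q - 1) * card norm_one" .
  moreover have "card ?S = (q - 1) * (q + 1)"
    by (simp only: card_Diff_singleton[OF UNIV_I] card_ext_minus_one)
  ultimately have "(q - 1) * (q + 1) \<le> (q - 1) * card norm_one"
    by (simp only:)
  then show "q + 1 \<le> card norm_one"
    using q unfolding mult_le_cancel1 by simp
qed

lemma theta0_eq: "theta0 d = (\<lambda>x. span {x}) ` norm_one"
  by (auto simp: theta0_def norm_one_def)

text \<open>Each point has exactly two norm-one representatives, \<open>x\<close> and
  \<open>- x\<close>, which are distinct in characteristic 3.\<close>

lemma card_theta0: "2 * card (theta0 d) = q + 1"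
proof -
  have "card norm_one = 2 * card ((\<lambda>x. span {x}) ` norm_one)"
  proof (rule card_eq_mult_card_image)
    fix P assume "P \<in> (\<lambda>x. span {x}) ` norm_one"
    then obtain x where x: "x \<in> norm_one" "P = span {x}" by blast
    then have "{y \<in> norm_one. span {y} = P} = {x, - x}"
      using norm_oneD(3)[OF x(1)] by (auto simp: span_single_eq_iff)
    then show "card {y \<in> norm_one. span {y} = P} = 2"
      using norm_oneD(4)[OF x(1)] by simp
  qed simp
  then show ?thesis by (simp add: theta0_eq card_norm_one)
qed

section \<open>Independence of at most four points\<close>

lemma norm_one_sum3:
  assumes U: "x \<in> norm_one" "y \<in> norm_one" "z \<in> norm_one" and sum: "x + y + z = 0"
  shows "x = y"
proof -
  note nz = U[THEN norm_oneD(1)]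
  have "x ^ q + y ^ q + z ^ q = 0"
    using sum conj_add[of "x + y" z] conj_add[of x y] by (simp add: zero_power)
  then have "inverse x + inverse y + inverse z = 0"
    using U by (simp add: norm_oneD(2))
  then have e2: "x * y + x * z + y * z = 0"
    using nz by (simp add: field_simps)
  have z: "z = - (x + y)"
    using sum by (metis add_eq_0_iff)
  \<comment> \<open>Substituting \<open>z\<close> turns the negated second symmetric function into
    \<open>x^2 + x y + y^2\<close>, which differs from \<open>(x - y)^2\<close> by three times
    \<open>x y\<close>.\<close>
  have "(x - y) * (x - y) = - (x * y + x * z + y * z) - (x * y + x * y + x * y)"
    unfolding z by (simp add: algebra_simps)
  also have "\<dots> = 0"
    unfolding e2 char_3 by simp
  finally show ?thesis by simp
qed

text \<open>The first and third elementary symmetric functions vanish, so the quartic with roots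
  \<open>x\<close>, \<open>y\<close>, \<open>z\<close>, \<open>w\<close> is even and its roots fall
  into opposite pairs. The two inequations keep \<open>x\<close> from being opposite to
  \<open>y\<close> or \<open>z\<close>.\<close>

lemma norm_one_sum4:
  assumes U: "x \<in> norm_one" "y \<in> norm_one" "z \<in> norm_one" "w \<in> norm_one"
    and sum: "x + y + z + w = 0" and "x + y \<noteq> 0" "x + z \<noteq> 0"
  shows "z = y \<or> z = - y"
proof -
  note nz = U[THEN norm_oneD(1)]
  have "x ^ q + y ^ q + z ^ q + w ^ q = 0"
    using sum conj_add[of "x + y + z" w] conj_add[of "x + y" z] conj_add[of x y]
    by (simp add: zero_power)
  then have "inverse x + inverse y + inverse z + inverse w = 0"
    using U by (simp add: norm_oneD(2))
  then have e3: "y * z * w + x * z * w + x * y * w + x * y * z = 0"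
    using nz by (simp add: field_simps)
  \<comment> \<open>Subtracting \<open>x y\<close> times the first symmetric function from the third
    leaves an expression with the factor \<open>x + y\<close>, which can be cancelled.\<close>
  have "(x + y) * (z * w - x * y)
      = (y * z * w + x * z * w + x * y * w + x * y * z) - x * y * (x + y + z + w)"
    by (simp add: algebra_simps)
  then have "(x + y) * (z * w - x * y) = 0" unfolding e3 sum by simp
  then have 1: "z * w = x * y" using assms by simp
  have "(x + z) * (y * w - x * z)
      = (y * z * w + x * z * w + x * y * w + x * y * z) - x * z * (x + y + z + w)"
    by (simp add: algebra_simps)
  then have "(x + z) * (y * w - x * z) = 0" unfolding e3 sum by simp
  then have 2: "y * w = x * z" using assms by simp
  \<comment> \<open>Both sides are products of the two relations:
    \<open>(z w) (x z) = (x y) (y w)\<close>.\<close>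
  have "(x * w) * (z * z) = (x * w) * (y * y)"
    using 1 2 by algebra
  then have "z * z = y * y" using nz by simp
  then show ?thesis by (simp add: square_eq_iff)
qed

lemma norm_one_sum_nonzero:
  assumes T: "T \<subseteq> norm_one" "T \<noteq> {}" "card T \<le> 4" and opp: "\<And>x. x \<in> T \<Longrightarrow> - x \<notin> T"
  shows "\<Sum>T \<noteq> 0"
proof
  assume 0: "\<Sum>T = 0"
  have "card T > 0" using T by (simp add: card_gt_0_iff)
  then consider "card T = 1" | "card T = 2" | "card T = 3" | "card T = 4"
    using T(3) by linarith
  then show False
  proof cases
    case 1
    then obtain x where "T = {x}" by (auto simp: card_1_singleton_iff)
    then show False using 0 T norm_oneD(1) by auto
  next
    case 2
    then obtain x y where "T = {x, y}" "x \<noteq> y" by (auto simp: card_2_iff)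
    then show False using 0 opp[of x] by (auto simp: add_eq_0_iff)
  next
    case 3
    then obtain x y z where xyz: "T = {x, y, z}" "x \<noteq> y" "x \<noteq> z" "y \<noteq> z"
      by (auto simp: card_3_iff)
    then have "x + y + z = 0" using 0 by (simp add: add.assoc)
    then show False using norm_one_sum3[of x y z] xyz T by auto
  next
    case 4
    then obtain w T' where T': "T = insert w T'" "w \<notin> T'" "card T' = 3"
      using card_Suc_eq[of T 3] by auto
    then obtain x y z where "T' = {x, y, z}" "x \<noteq> y" "x \<noteq> z" "y \<noteq> z"
      by (auto simp: card_3_iff)
    then have xyz: "T = {x, y, z, w}" "x \<noteq> y" "x \<noteq> z" "y \<noteq> z" "w \<notin> {x, y, z}"
      using T' by auto
    then have "x + y + z + w = 0" using 0 by (auto simp: add.assoc)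
    moreover have "x + y \<noteq> 0" "x + z \<noteq> 0" "z \<noteq> - y"
      using opp[of x] opp[of y] xyz by (auto simp: add_eq_0_iff)
    ultimately show False
      using norm_one_sum4[of x y z w] xyz T by auto
  qed
qed

text \<open>Nonzero scalars are signs and \<open>norm_one\<close> is closed under negation, so the
  nonzero terms of a linear relation are norm-one elements themselves. The relation becomes a plain
  vanishing sum of at most four of them.\<close>

lemma independent_norm_one:
  assumes S: "S \<subseteq> norm_one" "card S \<le> 4" and opp: "\<And>x. x \<in> S \<Longrightarrow> - x \<notin> S"
  shows "independent S"
proof
  assume "dependent S"
  then obtain c where c: "\<exists>v\<in>S. c v \<noteq> 0" "(\<Sum>v\<in>S. emb (c v) * v) = 0"
    by (auto simp: dependent_finite)
  define T where "T = {v \<in> S. c v \<noteq> 0}"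
  define g where "g v = emb (c v) * v" for v
  have g: "g v = v \<or> g v = - v" if "v \<in> T" for v
    using that emb_cases[of "c v"] by (auto simp: T_def g_def)
  \<comment> \<open>Allowing opposite values serves two purposes: distinct vectors give distinct
    terms, and no two terms are opposite.\<close>
  have inj: "u = v" if "u \<in> T" "v \<in> T" "g u = g v \<or> g u = - g v" for u v
    using that g[of u] g[of v] opp[of u] opp[of v] by (auto simp: T_def)
  have "\<Sum>(g ` T) = (\<Sum>v\<in>T. g v)"
    using inj by (subst sum.reindex) (auto simp: inj_on_def)
  also have "\<dots> = (\<Sum>v\<in>S. g v)"
    by (rule sum.mono_neutral_left) (auto simp: T_def g_def)
  also have "\<dots> = 0"
    using c by (simp add: g_def)
  finally have "\<Sum>(g ` T) = 0" .
  moreover have "\<Sum>(g ` T) \<noteq> 0"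
  proof (rule norm_one_sum_nonzero)
    show "g ` T \<subseteq> norm_one"
    proof
      fix y assume "y \<in> g ` T"
      then obtain v where "v \<in> T" "y = g v" by blast
      then show "y \<in> norm_one"
        using g[of v] norm_oneD(3)[of v] S by (auto simp: T_def)
    qed
    show "g ` T \<noteq> {}" using c by (auto simp: T_def)
    have "card (g ` T) \<le> card T" by (rule card_image_le) simp
    also have "\<dots> \<le> card S" by (intro card_mono) (auto simp: T_def)
    finally show "card (g ` T) \<le> 4" using S by simp
    show "- x \<notin> g ` T" if x: "x \<in> g ` T" for x
    proof
      assume "- x \<in> g ` T"
      then obtain u v where uv: "u \<in> T" "v \<in> T" "x = g u" "- x = g v"
        using x by (meson imageE)
      then have "u = v" using inj[of u v] by (metis minus_minus)
      then have "g u = - g u" using uv by simp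
      then have "g u = 0" by (metis neg_eq_iff)
      then have "u = 0" using g uv by force
      then show False using uv S norm_oneD(1) by (auto simp: T_def)
    qed
  qed
  ultimately show False by simp
qed

text \<open>One norm-one representative is chosen per point; distinct points then have
  representatives that are not opposite.\<close>

lemma theta0_representatives:
  assumes Y: "Y \<subseteq> theta0 d" "card Y \<le> 4"
  obtains S where "independent S" "card S = card Y" "S \<subseteq> \<Union>Y" "Y = (\<lambda>x. span {x}) ` S"
proof -
  obtain S where S: "S \<subseteq> norm_one" "inj_on (\<lambda>x. span {x}) S" "Y = (\<lambda>x. span {x}) ` S"
    using Y(1) unfolding theta0_eq by (auto simp: subset_image_inj)
  then have card: "card S = card Y" by (simp add: card_image)
  have "independent S"
  proof (rule independent_norm_one)
    show "- x \<notin> S" if "x \<in> S" for x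
    proof
      assume "- x \<in> S"
      moreover have "span {- x} = span {x}" by (simp add: span_single_eq_iff)
      ultimately have "- x = x" using S(2) that by (meson inj_onD)
      then show False using norm_oneD(4)[of x] S that by auto
    qed
  qed (use S Y card in auto)
  moreover have "S \<subseteq> \<Union>Y"
    using S by (auto intro: span_base)
  ultimately show ?thesis using that S card by blast
qed

section \<open>Sums of three norm-one elements\<close>

text \<open>On the norm-one group, \<open>x\<^sup>q = 1/x\<close> turns a prescribed norm of \<open>t - x\<close> into
  a quadratic equation for \<open>x\<close>.\<close>

lemma card_norm_diff_image:
  assumes "t \<noteq> 0"
  shows "q + 1 \<le> 2 * card ((\<lambda>x. (t - x) ^ (q + 1)) ` norm_one)"
proof -
  have "card norm_one \<le> 2 * card ((\<lambda>x. (t - x) ^ (q + 1)) ` norm_one)"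
  proof (rule card_le_mult_card_image)
    fix c
    let ?p = "[:t, c - t * t ^ q - 1, t ^ q:]"
    have "poly ?p x = 0" if "x \<in> norm_one" "(t - x) ^ (q + 1) = c" for x
    proof -
      have "c = (t - x) * (t ^ q - inverse x)"
        using that by (simp add: conj_diff norm_oneD(2))
      then show ?thesis
        using norm_oneD(1)[OF that(1)] by (simp add: field_simps)
    qed
    then have "card {x \<in> norm_one. (t - x) ^ (q + 1) = c} \<le> card {x. poly ?p x = 0}"
      by (intro card_mono) auto
    also have "\<dots> \<le> degree ?p"
      using assms by (intro card_poly_roots_bound) simp
    also have "\<dots> \<le> 2" by simp
    finally show "card {x \<in> norm_one. (t - x) ^ (q + 1) = c} \<le> 2" .
  qed simp
  then show ?thesis by (simp add: card_norm_one)
qed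

text \<open>A nonzero norm is a root of \<open>c ^ (q - 1) = 1\<close>, which leaves at most
  \<open>q - 1\<close> values besides 0.\<close>

lemma card_norms_le: "card (range (\<lambda>z :: 'a. z ^ (q + 1))) \<le> q"
proof -
  note q = one_less_q
  have "range (\<lambda>z :: 'a. z ^ (q + 1)) \<subseteq> insert 0 {c. c ^ (q - 1) = 1}"
    using power_card_minus_one by (auto simp: power_mult[symmetric] mult.commute simp del: power_Suc)
  then have "card (range (\<lambda>z :: 'a. z ^ (q + 1))) \<le> card (insert 0 {c :: 'a. c ^ (q - 1) = 1})"
    by (rule card_mono[rotated]) simp
  also have "\<dots> \<le> Suc (card {c :: 'a. c ^ (q - 1) = 1})"
    by (simp add: card_insert_if)
  also have "\<dots> \<le> q"
    using card_nth_roots_le[of "q - 1" "1 :: 'a"] q by simp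
  finally show ?thesis .
qed

lemma norm_one_sum3_surj:
  assumes "t \<noteq> 0" "t \<notin> norm_one"
  obtains x y z where "x \<in> norm_one" "y \<in> norm_one" "z \<in> norm_one" "t = x + y + z"
proof -
  let ?N = "\<lambda>s x. (s - x) ^ (q + 1) :: 'a"
  have "?N t ` norm_one \<inter> ?N (- 1) ` norm_one \<noteq> {}"
  proof
    assume "?N t ` norm_one \<inter> ?N (- 1) ` norm_one = {}"
    then have "card (?N t ` norm_one) + card (?N (- 1) ` norm_one)
        = card (?N t ` norm_one \<union> ?N (- 1) ` norm_one)"
      by (intro card_Un_disjoint[symmetric]) auto
    also have "\<dots> \<le> card (range (\<lambda>z :: 'a. z ^ (q + 1)))"
      by (intro card_mono) auto
    also have "\<dots> \<le> q" by (rule card_norms_le)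
    finally show False
      using card_norm_diff_image[of t] card_norm_diff_image[of "- 1"] assms(1) by simp
  qed
  then obtain x y where x: "x \<in> norm_one" and y: "y \<in> norm_one" and eq: "?N t x = ?N (- 1) y"
    by blast
  \<comment> \<open>Were the divisor zero, both norms would vanish and \<open>t = x\<close> would be
    a norm-one element.\<close>
  have ne: "- 1 - y \<noteq> 0"
  proof
    assume "- 1 - y = 0"
    then have "t - x = 0" using eq by simp
    then show False using x assms by simp
  qed
  define v where "v = (t - x) / (- 1 - y)"
  have v: "v \<in> norm_one"
    unfolding v_def using eq ne by (rule norm_one_divide)
  have "v * (- 1 - y) = t - x" using ne by (simp add: v_def)
  \<comment> \<open>This is why the second centre is \<open>- 1\<close>: the product
    \<open>v * (- 1 - y)\<close> splits into two norm-one summands.\<close>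
  then have "t = x + (- v) + (- (v * y))" by (simp add: algebra_simps)
  then show ?thesis
    using that x norm_oneD(3)[OF v] norm_oneD(3)[OF norm_one_mult[OF v y]] by blast
qed

text \<open>Gives both the spanning property and completeness. The three elements may coincide,
  which settles \<open>t = 0\<close> and \<open>t\<close> in \<open>norm_one\<close>.\<close>

lemma span_norm_one_cover:
  obtains x y z where "x \<in> norm_one" "y \<in> norm_one" "z \<in> norm_one" "t \<in> span {x, y, z}"
proof -
  have one: "1 \<in> norm_one" by (simp add: norm_one_def)
  consider "t = 0" | "t \<in> norm_one" | "t \<noteq> 0" "t \<notin> norm_one" by blast
  then show ?thesis
  proof cases
    case 1
    then show ?thesis using that[OF one one one] span_zero by simp
  next
    case 2
    then show ?thesis using that[OF 2 2 2] span_base by simp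
  next
    case 3
    then obtain x y z where "x \<in> norm_one" "y \<in> norm_one" "z \<in> norm_one" "t = x + y + z"
      by (rule norm_one_sum3_surj)
    then show ?thesis using that[of x y z] by (simp add: span_add span_base)
  qed
qed

section \<open>The set is 4-general and complete\<close>

lemma Union_theta0_superset: "norm_one \<subseteq> \<Union>(theta0 d)"
  unfolding theta0_eq by (auto intro: span_base)

lemma four_general_theta0: "four_general (theta0 d)"
  unfolding four_general_def
proof (intro conjI notI)
  show "theta0 d \<subseteq> proj_points"
  proof
    fix P assume "P \<in> theta0 d"
    then obtain x where "x \<in> norm_one" "P = span {x}" by (auto simp: theta0_eq)
    moreover from this have "independent {x}" by (simp add: norm_oneD(1))
    ultimately show "P \<in> proj_points"
      by (simp add: proj_points_def dim_eq_card_independent)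
  qed
  show "span (\<Union>(theta0 d)) = UNIV"
  proof (intro UNIV_eq_I[symmetric])
    fix t
    obtain x y z where "x \<in> norm_one" "y \<in> norm_one" "z \<in> norm_one" "t \<in> span {x, y, z}"
      by (rule span_norm_one_cover)
    then show "t \<in> span (\<Union>(theta0 d))"
      using Union_theta0_superset span_mono[of "{x, y, z}" "\<Union>(theta0 d)"] by blast
  qed
  assume "\<exists>Y\<subseteq>theta0 d. card Y = 4 \<and> (\<exists>E\<in>planes. \<forall>P\<in>Y. P \<subseteq> E)"
  then obtain Y E where Y: "Y \<subseteq> theta0 d" "card Y = 4" "E \<in> planes" "\<forall>P\<in>Y. P \<subseteq> E" by blast
  then have "card Y \<le> 4" by simp
  then obtain S where S: "independent S" "card S = card Y" "S \<subseteq> \<Union>Y"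
    and "Y = (\<lambda>x. span {x}) ` S"
    by (rule theta0_representatives[OF Y(1)])
  obtain B where "B \<subseteq> E" "independent B" and B: "E \<subseteq> span B" "card B = dim E"
    by (rule basis_exists)
  \<comment> \<open>A plane through the four points would contain four independent representatives,
    but a basis of it has only three elements.\<close>
  have "\<Union>Y \<subseteq> E" using Y(4) by blast
  then have "S \<subseteq> span B" using S(3) B(1) by (meson subset_trans)
  then have "card S \<le> card B"
    using independent_span_bound[of B S] S by simp
  then show False using S Y B by (simp add: planes_def)
qed

lemma complete_four_general_theta0: "complete_four_general (theta0 d)"
  unfolding complete_four_general_def
proof (intro conjI notI)
  show "four_general (theta0 d)" by (rule four_general_theta0)
  assume "\<exists>Y. four_general Y \<and> theta0 d \<subset> Y"
  then obtain Y P where Y: "four_general Y" "theta0 d \<subseteq> Y" and P: "P \<in> Y" "P \<notin> theta0 d"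
    by blast
  have "subspace P" "dim P = 1" using Y P by (auto simp: four_general_def proj_points_def)
  then obtain B where "B \<subseteq> P" "P \<subseteq> span B" "card B = 1"
    using basis_exists[of P] by metis
  then obtain t where t: "P \<subseteq> span {t}" by (auto simp: card_1_singleton_iff)
  obtain x y z where xyz: "x \<in> norm_one" "y \<in> norm_one" "z \<in> norm_one" "t \<in> span {x, y, z}"
    by (rule span_norm_one_cover)
  \<comment> \<open>The points of \<open>x\<close>, \<open>y\<close>, \<open>z\<close> may coincide
    and then span less than a plane. Since \<open>q\<close> is at least 9 there are enough points to
    enlarge them to a set \<open>X\<close> of three distinct ones.\<close>
  have "(3 :: nat) ^ 2 \<le> q" using d_ge_2 by (intro power_increasing) auto
  then have "3 \<le> card (theta0 d)" using card_theta0 by simp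
  moreover have "card {span {x}, span {y}, span {z}} \<le> 3"
    by (simp add: card_insert_if)
  moreover have "{span {x}, span {y}, span {z}} \<subseteq> theta0 d"
    using xyz by (simp add: theta0_eq)
  ultimately obtain X where X: "{span {x}, span {y}, span {z}} \<subseteq> X" "X \<subseteq> theta0 d" "card X = 3"
    using exists_subset_between[of "{span {x}, span {y}, span {z}}" 3 "theta0 d"]
    by (auto simp: theta0_eq)
  then have "card X \<le> 4" by simp
  then obtain S where "independent S" "card S = card X" "S \<subseteq> \<Union>X" "X = (\<lambda>x. span {x}) ` S"
    by (rule theta0_representatives[OF X(2)])
  then have S: "independent S" "card S = 3" "X = (\<lambda>x. span {x}) ` S"
    using X(3) by simp_all
  have sub: "Q \<subseteq> span S" if "Q \<in> X" for Q
  proof -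
    obtain s where "s \<in> S" "Q = span {s}" using \<open>Q \<in> X\<close> S(3) by blast
    then show ?thesis by (simp add: span_mono)
  qed
  have "w \<in> span S" if "span {w} \<in> X" for w
    using sub[OF that] span_base[of w "{w}"] by blast
  then have "{x, y, z} \<subseteq> span S"
    using X(1) by simp
  then have "t \<in> span S"
    using xyz(4) span_minimal[OF _ subspace_span] by blast
  then have P_sub: "P \<subseteq> span S"
    using t span_minimal[OF _ subspace_span, of "{t}" S] by blast
  have "span S \<in> planes"
    using S by (simp add: planes_def dim_eq_card_independent)
  \<comment> \<open>The new point is outside \<open>theta0 d\<close> and hence differs from the
    three points of \<open>X\<close>.\<close>
  moreover have "card (insert P X) = 4"
    using X P by (subst card_insert_disjoint) (auto intro: card_ge_0_finite)
  moreover have "insert P X \<subseteq> Y" using X Y P by blast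
  moreover have "\<forall>Q\<in>insert P X. Q \<subseteq> span S"
    using P_sub sub by simp
  ultimately have "\<exists>Z\<subseteq>Y. card Z = 4 \<and> (\<exists>E\<in>planes. \<forall>Q\<in>Z. Q \<subseteq> E)"
    by (intro exI[of _ "insert P X"] conjI bexI[of _ "span S"])
  then show False
    using Y(1) unfolding four_general_def by simp
qed

end

theorem theorem4p1:
  fixes d :: nat and emb :: "'k::field \<Rightarrow> 'a::field"
  assumes "d \<ge> 2"
    and "CARD('k) = 3" and "CARD('a) = 3 ^ (2 * d)"
    and "field_extension emb"
  shows "projective_space.complete_four_general (\<lambda>c x. emb c * x) (field_extension.theta0 emb d)
    \<and> card (field_extension.theta0 emb d) = (3 ^ d + 1) div 2"
proof -
  interpret ternary_extension emb d
    using assms by (simp add: ternary_extension_def ternary_extension_axioms_def)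
  show ?thesis
    using complete_four_general_theta0 card_theta0 by simp
qed

end
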